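(* Let $\mathsf{H}$ be a (right) quaternionic Hilbert space and let $T:\mathsf{H}\to\mathsf{H}$ be a right $\mathbb{H}$-linear operator that is compact and normal. Then there exist a Hilbert basis $\mathcal{N}\subset\mathsf{H}$ made of eigenvectors of $T$ and, for each $z\in\mathcal{N}$, an eigenvalue $\lambda_z\in\mathbb{H}$ of $T$ relative to the eigenvector $z$ (i.e. $Tz=z\lambda_z$), such that the following hold. 1. $Tx=\sum_{z\in\mathcal{N}}z\lambda_z\langle z|x\rangle$ for each $x\in\mathsf{H}$. 2. If $z\in\mathcal{N}$ and $\lambda_z\neq0$, then only a finite number of distinct other elements $z'\in\mathcal{N}$ satisfy $\lambda_z=\lambda_{z'}$; moreover the values $\lambda_z$ are at most countably many. 3. The set $\Lambda:=\{\lambda_z : z\in\mathcal{N}\}$ vanishes at infinity, in the sense that for every $\epsilon>0$ there is a finite set $\Lambda_\epsilon\subset\Lambda$ such that $|\lambda|<\epsilon$ for every $\lambda\in\Lambda\setminus\Lambda_\epsilon$. Thus $0$ is the only possible accumulation point of $\Lambda$. 4. If $\mathsf{H}$ is infinite-dimensional, then $0$ belongs to the spherical spectrum $\sigma_S(T)$.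
   Context: $\mathbb{H}$ denotes the skew field of quaternions, with conjugation $q\mapsto\overline{q}$ and norm $|q|=\sqrt{\overline{q}q}$. A (right) quaternionic Hilbert space is a right $\mathbb{H}$-module $\mathsf{H}$ with a map $\mathsf{H}\times\mathsf{H}\ni(u,v)\mapsto\langle u|v\rangle\in\mathbb{H}$ such that $\langle u|vp+wq\rangle=\langle u|v\rangle p+\langle u|w\rangle q$, $\langle u|v\rangle=\overline{\langle v|u\rangle}$, $\langle u|u\rangle$ is a real number $\ge 0$, and $\langle u|u\rangle=0$ implies $u=0$ (for all $u,v,w\in\mathsf{H}$, $p,q\in\mathbb{H}$), and which is complete for the norm $\|u\|=\sqrt{\langle u|u\rangle}$. A Hilbert basis of $\mathsf{H}$ is an orthonormal subset $\mathcal{N}$ (possibly uncountable) such that $x=\sum_{z\in\mathcal{N}}z\langle z|x\rangle$ for every $x\in\mathsf{H}$; sums over $\mathcal{N}$ are unconditional sums converging in norm. A map $T:\mathsf{H}\to\mathsf{H}$ is right $\mathbb{H}$-linear if $T(ua+vb)=(Tu)a+(Tv)b$ for all $u,v\in\mathsf{H}$, $a,b\in\mathbb{H}$. It is bounded if there is $K\ge0$ with $\|Tu\|\le K\|u\|$ for all $u$; $\mathfrak{B}(\mathsf{H})$ is the set of bounded right $\mathbb{H}$-linear operators $\mathsf{H}\to\mathsf{H}$. A right $\mathbb{H}$-linear $T$ is compact if it maps bounded sequences to sequences admitting convergent subsequences (compact operators are bounded). The adjoint $T^*$ of $T\in\mathfrak{B}(\mathsf{H})$ is defined by $\langle T^*u|v\rangle=\langle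 u|Tv\rangle$ for all $u,v$; $T$ is normal if $TT^*=T^*T$. A vector $u\neq0$ is an eigenvector of $T$ with eigenvalue $q\in\mathbb{H}$ if $Tu=uq$. For $T\in\mathfrak{B}(\mathsf{H})$ and $q\in\mathbb{H}$ put $\Delta_q(T):=T^2-T(q+\overline{q})+\mathrm{I}|q|^2$, where $\mathrm{I}$ is the identity and for $r\in\mathbb{R}$ the operator $Tr$ is $u\mapsto (Tu)r$. The spherical resolvent set $\rho_S(T)$ is the set of $q\in\mathbb{H}$ such that $\mathrm{Ker}(\Delta_q(T))=\{0\}$, $\mathrm{Range}(\Delta_q(T))$ is dense in $\mathsf{H}$, and $\Delta_q(T)^{-1}:\mathrm{Range}(\Delta_q(T))\to\mathsf{H}$ is bounded. The spherical spectrum is $\sigma_S(T):=\mathbb{H}\setminus\rho_S(T)$. *)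

theory Defs
  imports "HOL-Analysis.Analysis"
begin

section \<open>Quaternions\<close>

codatatype quat = Quat (qRe: real) (qIm1: real) (qIm2: real) (qIm3: real)

lemma quat_eqI:
  "qRe p = qRe q \<Longrightarrow> qIm1 p = qIm1 q \<Longrightarrow> qIm2 p = qIm2 q \<Longrightarrow> qIm3 p = qIm3 q \<Longrightarrow> p = q"
  by (rule quat.expand) simp

lemma quat_eq_iff:
  "p = q \<longleftrightarrow> qRe p = qRe q \<and> qIm1 p = qIm1 q \<and> qIm2 p = qIm2 q \<and> qIm3 p = qIm3 q"
  by (auto intro: quat_eqI)

primcorec qcnj :: "quat \<Rightarrow> quat" where
  "qRe (qcnj q) = qRe q"
| "qIm1 (qcnj q) = - qIm1 q"
| "qIm2 (qcnj q) = - qIm2 q"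
| "qIm3 (qcnj q) = - qIm3 q"

instantiation quat :: ring_1
begin

primcorec zero_quat where
  "qRe 0 = 0" | "qIm1 0 = 0" | "qIm2 0 = 0" | "qIm3 0 = 0"

primcorec one_quat where
  "qRe 1 = 1" | "qIm1 1 = 0" | "qIm2 1 = 0" | "qIm3 1 = 0"

primcorec plus_quat where
  "qRe (p + q) = qRe p + qRe q"
| "qIm1 (p + q) = qIm1 p + qIm1 q"
| "qIm2 (p + q) = qIm2 p + qIm2 q"
| "qIm3 (p + q) = qIm3 p + qIm3 q"

primcorec uminus_quat where
  "qRe (- q) = - qRe q"
| "qIm1 (- q) = - qIm1 q"
| "qIm2 (- q) = - qIm2 q"
| "qIm3 (- q) = - qIm3 q"

primcorec minus_quat where
  "qRe (p - q) = qRe p - qRe q"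
| "qIm1 (p - q) = qIm1 p - qIm1 q"
| "qIm2 (p - q) = qIm2 p - qIm2 q"
| "qIm3 (p - q) = qIm3 p - qIm3 q"

primcorec times_quat where
  "qRe (p * q) = qRe p * qRe q - qIm1 p * qIm1 q - qIm2 p * qIm2 q - qIm3 p * qIm3 q"
| "qIm1 (p * q) = qRe p * qIm1 q + qIm1 p * qRe q + qIm2 p * qIm3 q - qIm3 p * qIm2 q"
| "qIm2 (p * q) = qRe p * qIm2 q - qIm1 p * qIm3 q + qIm2 p * qRe q + qIm3 p * qIm1 q"
| "qIm3 (p * q) = qRe p * qIm3 q + qIm1 p * qIm2 q - qIm2 p * qIm1 q + qIm3 p * qRe q"

instance
  by standard (simp_all add: quat_eq_iff algebra_simps)

end

instantiation quat :: real_algebra_1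
begin

primcorec scaleR_quat where
  "qRe (r *\<^sub>R q) = r * qRe q"
| "qIm1 (r *\<^sub>R q) = r * qIm1 q"
| "qIm2 (r *\<^sub>R q) = r * qIm2 q"
| "qIm3 (r *\<^sub>R q) = r * qIm3 q"

instance
  by standard (simp_all add: quat_eq_iff algebra_simps)

end

lemma quat_of_real_sel [simp]:
  "qRe (of_real r) = r" "qIm1 (of_real r) = 0" "qIm2 (of_real r) = 0" "qIm3 (of_real r) = 0"
  by (simp_all add: of_real_def)

lemma qcnj_mult [simp]: "qcnj (p * q) = qcnj q * qcnj p"
  by (simp add: quat_eq_iff algebra_simps)

lemma qcnj_qcnj [simp]: "qcnj (qcnj q) = q"
  by (simp add: quat_eq_iff)

lemma qcnj_add [simp]: "qcnj (p + q) = qcnj p + qcnj q"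
  by (simp add: quat_eq_iff)

lemma qcnj_minus [simp]: "qcnj (- p) = - qcnj p"
  by (simp add: quat_eq_iff)

lemma qcnj_diff [simp]: "qcnj (p - q) = qcnj p - qcnj q"
  by (simp add: quat_eq_iff)

lemma qcnj_of_real [simp]: "qcnj (of_real r) = of_real r"
  by (simp add: quat_eq_iff)

lemma quat_of_real_commute: "of_real r * q = q * (of_real r :: quat)"
  by (simp add: quat_eq_iff)

lemma quat_Reals_iff: "q \<in> \<real> \<longleftrightarrow> q = of_real (qRe q)"
  by (metis Reals_cases Reals_of_real quat_of_real_sel(1))

instantiation quat :: real_normed_div_algebra
begin

definition norm_quat :: "quat \<Rightarrow> real" where
  "norm_quat q = sqrt (qRe (qcnj q * q))"

definition sgn_quat :: "quat \<Rightarrow> quat" where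
  "sgn_quat q = inverse (norm q) *\<^sub>R q"

definition dist_quat :: "quat \<Rightarrow> quat \<Rightarrow> real" where
  "dist_quat p q = norm (p - q)"

definition uniformity_quat :: "(quat \<times> quat) filter" where
  "uniformity_quat = (INF e\<in>{0 <..}. principal {(x, y). dist x y < e})"

definition open_quat :: "quat set \<Rightarrow> bool" where
  "open_quat U \<longleftrightarrow> (\<forall>x\<in>U. eventually (\<lambda>(x', y). x' = x \<longrightarrow> y \<in> U) uniformity)"

definition inverse_quat :: "quat \<Rightarrow> quat" where
  "inverse_quat q = inverse ((norm q)\<^sup>2) *\<^sub>R qcnj q"

definition divide_quat :: "quat \<Rightarrow> quat \<Rightarrow> quat" where
  "divide_quat p q = p * inverse q"

lemma norm_quat_components:
  "norm q = sqrt ((qRe q)\<^sup>2 + (qIm1 q)\<^sup>2 + (qIm2 q)\<^sup>2 + (qIm3 q)\<^sup>2)"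
  by (simp add: norm_quat_def power2_eq_square algebra_simps)

lemma norm_quat_prod: "norm q = norm ((qRe q, qIm1 q), (qIm2 q, qIm3 q))"
  by (simp add: norm_quat_components norm_prod_def)

lemma norm_quat_sq: "(norm q)\<^sup>2 = (qRe q)\<^sup>2 + (qIm1 q)\<^sup>2 + (qIm2 q)\<^sup>2 + (qIm3 q)\<^sup>2"
  by (simp add: norm_quat_components)

lemma qcnj_mult_self: "qcnj q * q = of_real ((norm q)\<^sup>2)"
  by (simp add: quat_eq_iff norm_quat_sq del: of_real_power) (simp add: power2_eq_square)

lemma mult_qcnj_self: "q * qcnj q = of_real ((norm q)\<^sup>2)"
  by (simp add: quat_eq_iff norm_quat_sq del: of_real_power) (simp add: power2_eq_square)

instance
proof
  fix x y :: quat and a :: real and U :: "quat set"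
  show "dist x y = norm (x - y)" by (rule dist_quat_def)
  show "sgn x = inverse (norm x) *\<^sub>R x" by (rule sgn_quat_def)
  show "uniformity = (INF e\<in>{0 <..}. principal {(x::quat, y). dist x y < e})"
    by (rule uniformity_quat_def)
  show "open U \<longleftrightarrow> (\<forall>x\<in>U. \<forall>\<^sub>F (x', y) in uniformity. x' = x \<longrightarrow> y \<in> U)"
    by (rule open_quat_def)
  show norm0: "norm x = 0 \<longleftrightarrow> x = 0" for x :: quat
    unfolding norm_quat_prod norm_eq_zero by (simp add: quat_eq_iff zero_prod_def)
  show "norm (x + y) \<le> norm x + norm y"
    using norm_triangle_ineq[of "((qRe x, qIm1 x), (qIm2 x, qIm3 x))" "((qRe y, qIm1 y), (qIm2 y, qIm3 y))"]
    by (simp add: norm_quat_prod)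
  show "norm (a *\<^sub>R x) = \<bar>a\<bar> * norm x"
    using norm_scaleR[of a "((qRe x, qIm1 x), (qIm2 x, qIm3 x))"]
    by (simp add: norm_quat_prod)
  have nn: "0 \<le> norm z" for z :: quat
    unfolding norm_quat_prod by (rule norm_ge_zero)
  have "(norm (x * y))\<^sup>2 = (norm x * norm y)\<^sup>2"
    by (simp add: norm_quat_sq power_mult_distrib) (simp add: power2_eq_square algebra_simps)
  then show "norm (x * y) = norm x * norm y"
    by (simp add: nn power2_eq_iff_nonneg)
  show "inverse x * x = 1" if "x \<noteq> 0"
    using that norm0[of x] by (simp add: inverse_quat_def qcnj_mult_self del: of_real_power)
      (simp add: of_real_def)
  show "x * inverse x = 1" if "x \<noteq> 0"
    using that norm0[of x] by (simp add: inverse_quat_def mult_qcnj_self del: of_real_power)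
      (simp add: of_real_def)
  show "x div y = x * inverse y" by (rule divide_quat_def)
  show "inverse (0::quat) = 0" by (simp add: inverse_quat_def quat_eq_iff)
qed

end


section \<open>Right quaternionic Hilbert spaces\<close>

class quat_module = ab_group_add +
  fixes scaleQ :: "'a \<Rightarrow> quat \<Rightarrow> 'a" (infixl \<open>*\<^sub>Q\<close> 75)
  assumes scaleQ_add_left: "(u + v) *\<^sub>Q q = u *\<^sub>Q q + v *\<^sub>Q q"
    and scaleQ_add_right: "u *\<^sub>Q (p + q) = u *\<^sub>Q p + u *\<^sub>Q q"
    and scaleQ_scaleQ: "u *\<^sub>Q p *\<^sub>Q q = u *\<^sub>Q (p * q)"
    and scaleQ_one: "u *\<^sub>Q 1 = u"

class quat_inner = quat_module +
  fixes qinner :: "'a \<Rightarrow> 'a \<Rightarrow> quat"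
  assumes qinner_right: "qinner u (v *\<^sub>Q p + w *\<^sub>Q q) = qinner u v * p + qinner u w * q"
    and qinner_cnj: "qinner u v = qcnj (qinner v u)"
    and qinner_self_real: "qinner u u \<in> \<real>"
    and qinner_self_nonneg: "0 \<le> qRe (qinner u u)"
    and qinner_self_zero: "qinner u u = 0 \<Longrightarrow> u = 0"

text \<open>
  The class \<^class>\<open>banach\<close> supplies the library notions of convergence and completeness. Its
  real scaling and its norm, hence also its distance and topology, are determined by the
  quaternionic structure through the two equations below. The vector space and norm axioms
  of \<^class>\<open>banach\<close> are no restriction, since they hold for these operations in every
  \<^class>\<open>quat_inner\<close> (by Cauchy--Schwarz); only completeness is an additional condition.
\<close>

class quat_hilbert = quat_inner + banach +
  assumes scaleR_scaleQ: "r *\<^sub>R u = u *\<^sub>Q of_real r"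
    and norm_qinner: "norm u = sqrt (qRe (qinner u u))"

text \<open>The library predicate \<^const>\<open>has_sum\<close> is unconditional summation, here for the norm topology.\<close>

definition hilbert_basis :: "'a::quat_hilbert set \<Rightarrow> bool" where
  "hilbert_basis N \<longleftrightarrow>
     (\<forall>z\<in>N. \<forall>z'\<in>N. qinner z z' = (if z = z' then 1 else 0)) \<and>
     (\<forall>x. ((\<lambda>z. z *\<^sub>Q qinner z x) has_sum x) N)"

definition finite_dimensional_quat :: "'a::quat_module itself \<Rightarrow> bool" where
  "finite_dimensional_quat _ \<longleftrightarrow>
     (\<exists>B::'a set. finite B \<and> (\<forall>x. \<exists>c. x = (\<Sum>b\<in>B. b *\<^sub>Q c b)))"


section \<open>Operators\<close>

definition right_linear :: "('a::quat_module \<Rightarrow> 'a) \<Rightarrow> bool" where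
  "right_linear T \<longleftrightarrow> (\<forall>u v a b. T (u *\<^sub>Q a + v *\<^sub>Q b) = T u *\<^sub>Q a + T v *\<^sub>Q b)"

definition compact_operator :: "('a::quat_hilbert \<Rightarrow> 'a) \<Rightarrow> bool" where
  "compact_operator T \<longleftrightarrow> right_linear T \<and>
     (\<forall>x::nat \<Rightarrow> 'a. bounded (range x) \<longrightarrow>
        (\<exists>r::nat \<Rightarrow> nat. strict_mono r \<and> convergent (T \<circ> x \<circ> r)))"

text \<open>For bounded right linear operators the adjoint exists by the Riesz representation theorem,
  and it is unique since the inner product is nondegenerate.\<close>

definition quat_adjoint :: "('a::quat_hilbert \<Rightarrow> 'a) \<Rightarrow> 'a \<Rightarrow> 'a" where
  "quat_adjoint T = (THE S. \<forall>u v. qinner (S u) v = qinner u (T v))"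

definition normal_operator :: "('a::quat_hilbert \<Rightarrow> 'a) \<Rightarrow> bool" where
  "normal_operator T \<longleftrightarrow> T \<circ> quat_adjoint T = quat_adjoint T \<circ> T"

definition eigenvector :: "('a::quat_module \<Rightarrow> 'a) \<Rightarrow> 'a \<Rightarrow> quat \<Rightarrow> bool" where
  "eigenvector T u q \<longleftrightarrow> u \<noteq> 0 \<and> T u = u *\<^sub>Q q"

definition Delta :: "('a::quat_module \<Rightarrow> 'a) \<Rightarrow> quat \<Rightarrow> 'a \<Rightarrow> 'a" where
  "Delta T q u = T (T u) - T u *\<^sub>Q (q + qcnj q) + u *\<^sub>Q of_real ((norm q)\<^sup>2)"

definition spherical_resolvent :: "('a::quat_hilbert \<Rightarrow> 'a) \<Rightarrow> quat set" where
  "spherical_resolvent T =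
     {q. {u. Delta T q u = 0} = {0} \<and>
         closure (range (Delta T q)) = UNIV \<and>
         (\<exists>K\<ge>0. \<forall>y\<in>range (Delta T q). norm (inv (Delta T q) y) \<le> K * norm y)}"

definition spherical_spectrum :: "('a::quat_hilbert \<Rightarrow> 'a) \<Rightarrow> quat set" where
  "spherical_spectrum T = - spherical_resolvent T"

end

theory Submission
  imports Defs
begin

text \<open>
  A maximal orthonormal set of eigenvectors is a Hilbert basis as soon as every nonzero closed
  subspace \<open>M\<close> invariant under \<open>T\<close> and its adjoint \<open>S\<close> contains an eigenvector; note that an
  eigenvector of \<open>T\<close> with eigenvalue \<open>q\<close> is one of \<open>S\<close> with eigenvalue \<^term>\<open>qcnj q\<close>, so orthogonal
  complements are invariant. Since \<open>u \<mapsto> u *\<^sub>Q q\<close> is not right linear for non-real \<open>q\<close>, the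
  eigenvector is found through real eigenvalues: compactness gives a real eigenvalue \<open>c\<^sup>2\<close> of \<open>S \<circ> T\<close> on
  \<open>M\<close>, then a real eigenvalue of \<open>T + S\<close> on the corresponding eigenspace. There \<open>T\<close> satisfies a real
  quadratic equation, which factors over the quaternions, and a factor yields the eigenvector.
  Finiteness of the set of eigenvalues away from \<open>0\<close> is compactness again.
\<close>

section \<open>The inner product\<close>

lemma scaleQ_zero_right [simp]: "(u::'a::quat_module) *\<^sub>Q 0 = 0"
  using scaleQ_add_right[of u 0 0] by simp

lemma scaleQ_zero_left [simp]: "(0::'a::quat_module) *\<^sub>Q q = 0"
  using scaleQ_add_left[of "0::'a" 0 q] by simp

lemma scaleQ_minus_right [simp]: "(u::'a::quat_module) *\<^sub>Q (- q) = - (u *\<^sub>Q q)"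
  using scaleQ_add_right[of u q "- q"] by (simp add: add_eq_0_iff)

lemma scaleQ_minus_left [simp]: "(- (u::'a::quat_module)) *\<^sub>Q q = - (u *\<^sub>Q q)"
  using scaleQ_add_left[of u "- u" q] by (simp add: add_eq_0_iff)

lemma scaleQ_diff_left: "((u::'a::quat_module) - v) *\<^sub>Q q = u *\<^sub>Q q - v *\<^sub>Q q"
  using scaleQ_add_left[of u "- v" q] by simp

lemma qinner_add_right: "qinner (u::'a::quat_inner) (v + w) = qinner u v + qinner u w"
  using qinner_right[of u v 1 w 1] by (simp add: scaleQ_one)

lemma qinner_scaleQ_right: "qinner (u::'a::quat_inner) (v *\<^sub>Q q) = qinner u v * q"
  using qinner_right[of u v q 0 0] by simp

lemma qinner_zero_right [simp]: "qinner (u::'a::quat_inner) 0 = 0"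
  using qinner_scaleQ_right[of u 0 0] by simp

lemma qinner_minus_right [simp]: "qinner (u::'a::quat_inner) (- v) = - qinner u v"
  using qinner_add_right[of u v "- v"] by (simp add: add_eq_0_iff)

lemma qinner_diff_right: "qinner (u::'a::quat_inner) (v - w) = qinner u v - qinner u w"
  using qinner_add_right[of u v "- w"] by simp

lemma qinner_add_left: "qinner ((u::'a::quat_inner) + v) w = qinner u w + qinner v w"
  by (metis qcnj_add qinner_add_right qinner_cnj)

lemma qinner_scaleQ_left: "qinner ((u::'a::quat_inner) *\<^sub>Q q) v = qcnj q * qinner u v"
  by (metis qcnj_mult qinner_cnj qinner_scaleQ_right)

lemma qinner_zero_left [simp]: "qinner (0::'a::quat_inner) v = 0"
  using qinner_scaleQ_left[of 0 0 v] by (simp add: quat_eq_iff)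

lemma qinner_minus_left [simp]: "qinner (- (u::'a::quat_inner)) v = - qinner u v"
  using qinner_add_left[of u "- u" v] by (simp add: add_eq_0_iff)

lemma qinner_diff_left: "qinner ((u::'a::quat_inner) - v) w = qinner u w - qinner v w"
  using qinner_add_left[of u "- v" w] by simp

lemma qinner_sum_right: "qinner (u::'a::quat_inner) (sum f A) = (\<Sum>x\<in>A. qinner u (f x))"
  by (induction A rule: infinite_finite_induct) (simp_all add: qinner_add_right)

lemma qRe_sum: "qRe (sum f A) = (\<Sum>x\<in>A. qRe (f x))"
  by (induction A rule: infinite_finite_induct) simp_all

lemma qRe_le_norm: "\<bar>qRe q\<bar> \<le> norm q"
  unfolding norm_quat_components by (rule real_le_rsqrt) simp

lemma norm_qcnj [simp]: "norm (qcnj q) = norm q"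
  by (simp add: norm_quat_components)

text \<open>Testing against \<open>q = qcnj (p - p')\<close> yields the squared norm of the
  difference. This lifts identities between real parts to quaternionic ones.\<close>

lemma quat_eqI_qRe_mult:
  assumes "\<And>q. qRe (p * q) = qRe (p' * q)"
  shows "p = p'"
proof -
  have "qRe ((p - p') * qcnj (p - p')) = 0"
    using assms[of "qcnj (p - p')"] by (simp add: algebra_simps)
  then have "(norm (p - p'))\<^sup>2 = 0"
    unfolding mult_qcnj_self by (simp del: of_real_power)
  then show ?thesis by simp
qed

text \<open>The real part is a real inner product inducing the same norm, so arguments from real
  Hilbert spaces apply to it.\<close>

abbreviation rinner :: "'a::quat_inner \<Rightarrow> 'a \<Rightarrow> real" where
  "rinner u v \<equiv> qRe (qinner u v)"

lemma rinner_sym: "rinner u v = rinner v u"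
  by (metis qcnj.simps(1) qinner_cnj)

lemma rinner_scaleR_right: "rinner (u::'a::quat_hilbert) (r *\<^sub>R v) = r * rinner u v"
  by (simp add: scaleR_scaleQ qinner_scaleQ_right)

lemma norm_sq_rinner: "(norm (u::'a::quat_hilbert))\<^sup>2 = rinner u u"
  by (simp add: norm_qinner qinner_self_nonneg)

lemma qinner_self: "qinner u u = of_real ((norm (u::'a::quat_hilbert))\<^sup>2)"
  using qinner_self_real[of u] by (simp add: quat_Reals_iff norm_sq_rinner del: of_real_power)

lemma norm_add_sq: "(norm ((u::'a::quat_hilbert) + v))\<^sup>2 = (norm u)\<^sup>2 + 2 * rinner u v + (norm v)\<^sup>2"
  by (simp add: norm_sq_rinner qinner_add_left qinner_add_right rinner_sym[of v u])

lemma norm_diff_sq: "(norm ((u::'a::quat_hilbert) - v))\<^sup>2 = (norm u)\<^sup>2 - 2 * rinner u v + (norm v)\<^sup>2"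
  by (simp add: norm_sq_rinner qinner_diff_left qinner_diff_right rinner_sym[of v u])

text \<open>The inner product of \<open>u\<close> with itself is real, hence central, so the two
  factors \<open>qcnj q\<close> and \<open>q\<close> meet and give the squared norm of
  \<open>q\<close>.\<close>

lemma norm_scaleQ: "norm ((u::'a::quat_hilbert) *\<^sub>Q q) = norm u * norm q"
proof -
  have "qinner (u *\<^sub>Q q) (u *\<^sub>Q q) = qcnj q * (qinner u u * q)"
    by (simp add: qinner_scaleQ_left qinner_scaleQ_right mult.assoc)
  also have "\<dots> = qcnj q * q * of_real ((norm u)\<^sup>2)"
    by (simp only: qinner_self quat_of_real_commute mult.assoc)
  also have "\<dots> = of_real ((norm q)\<^sup>2 * (norm u)\<^sup>2)"
    by (simp only: qcnj_mult_self of_real_mult)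
  finally have "(norm (u *\<^sub>Q q))\<^sup>2 = (norm q)\<^sup>2 * (norm u)\<^sup>2"
    unfolding norm_sq_rinner[of "u *\<^sub>Q q"] by (simp only: quat_of_real_sel)
  then have "(norm (u *\<^sub>Q q))\<^sup>2 = (norm u * norm q)\<^sup>2"
    by (simp add: power_mult_distrib mult.commute)
  then show ?thesis
    by (simp add: power2_eq_iff_nonneg)
qed

text \<open>The triangle inequality is already a class axiom; squaring it and cancelling leaves the
  real Cauchy-Schwarz inequality.\<close>

lemma rinner_le_norm: "rinner u v \<le> norm u * norm (v::'a::quat_hilbert)"
proof -
  have "(norm (u + v))\<^sup>2 \<le> (norm u + norm v)\<^sup>2"
    by (rule power_mono) (simp_all add: norm_triangle_ineq)
  then show ?thesis
    unfolding norm_add_sq by (simp add: power2_sum)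
qed

text \<open>Multiplying \<open>v\<close> on the right by \<open>qcnj (qinner u v)\<close> makes the
  inner product real, which reduces the claim to the bound for \<open>rinner\<close>.\<close>

lemma norm_qinner_le: "norm (qinner u v) \<le> norm u * norm (v::'a::quat_hilbert)"
proof (cases "qinner u v = 0")
  case False
  have "(norm (qinner u v))\<^sup>2 = rinner u (v *\<^sub>Q qcnj (qinner u v))"
    unfolding qinner_scaleQ_right mult_qcnj_self by (simp del: of_real_power)
  also have "\<dots> \<le> norm u * (norm v * norm (qinner u v))"
    using rinner_le_norm[of u "v *\<^sub>Q qcnj (qinner u v)"] by (simp add: norm_scaleQ)
  finally have "norm (qinner u v) * norm (qinner u v) \<le> (norm u * norm v) * norm (qinner u v)"
    by (simp add: power2_eq_square mult.assoc)
  then show ?thesis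
    using False by (meson mult_right_le_imp_le zero_less_norm_iff)
qed simp

lemma bounded_linear_qinner: "bounded_linear (qinner (u::'a::quat_hilbert))"
proof (rule bounded_linear_intro)
  show "qinner u (r *\<^sub>R x) = r *\<^sub>R qinner u x" for r x
    by (simp add: scaleR_scaleQ qinner_scaleQ_right flip: quat_of_real_commute)
      (simp add: of_real_def)
  show "norm (qinner u x) \<le> norm x * norm u" for x
    by (metis mult.commute norm_qinner_le)
qed (rule qinner_add_right)

section \<open>Riesz representation and adjoints\<close>

text \<open>The representing vector minimises \<^term>\<open>(norm u)\<^sup>2 - 2 * g u\<close>; by the parallelogram law,
  minimising sequences are Cauchy.\<close>

lemma riesz_representation:
  fixes g :: "'a::quat_hilbert \<Rightarrow> real"
  assumes "bounded_linear g"
  obtains u where "\<And>v. rinner u v = g v"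
proof -
  interpret g: bounded_linear g by fact
  obtain c where c: "\<And>x. \<bar>g x\<bar> \<le> norm x * c"
    using g.bounded by auto
  define J where "J u = (norm u)\<^sup>2 - 2 * g u" for u
  have "J u \<ge> - c\<^sup>2" for u
  proof -
    \<comment> \<open>Completing the square: \<open>J u\<close> is at least the square of
      \<open>norm u\<close> minus \<open>2 * c * norm u\<close>.\<close>
    have "0 \<le> (norm u - c)\<^sup>2" by simp
    then show ?thesis
      using c[of u] unfolding J_def power2_diff by (simp add: mult.commute)
  qed
  then have bdd: "bdd_below (range J)" by (intro bdd_belowI2)
  define m where "m = Inf (range J)"
  have m_le: "m \<le> J u" for u
    unfolding m_def using bdd by (intro cInf_lower) auto
  have "\<exists>u. J u < m + e" if "e > 0" for e
  proof -
    have "Inf (range J) < m + e" using that by (simp add: m_def)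
    then show ?thesis using cInf_lessD[of "range J"] by auto
  qed
  then have "\<exists>u. J u < m + 1 / real (Suc n)" for n by simp
  then obtain U where U: "J (U n) < m + 1 / real (Suc n)" for n by metis
  have parallelogram: "(norm (u - v))\<^sup>2 \<le> 2 * (J u - m) + 2 * (J v - m)" for u v
  proof -
    \<comment> \<open>The infimum also bounds \<open>J\<close> at the midpoint; this controls the
      distance of two near-minimisers.\<close>
    have "m \<le> J ((1/2) *\<^sub>R (u + v))" by (rule m_le)
    also have "\<dots> = (norm (u + v))\<^sup>2 / 4 - g u - g v"
      unfolding J_def by (simp add: g.scaleR g.add power_divide add_divide_distrib)
    finally show ?thesis
      unfolding J_def norm_add_sq norm_diff_sq by (simp add: algebra_simps)
  qed
  have "Cauchy U"
  proof (rule metric_CauchyI)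
    fix e :: real assume e: "e > 0"
    then obtain k where k: "1 / real (Suc k) < e\<^sup>2 / 4"
      using nat_approx_posE[of "e\<^sup>2 / 4"] by auto
    have small: "J (U n) - m < e\<^sup>2 / 4" if "n \<ge> k" for n
    proof -
      have "1 / real (Suc n) \<le> 1 / real (Suc k)" using that by (simp add: frac_le)
      then show ?thesis using U[of n] k by linarith
    qed
    have "dist (U i) (U j) < e" if "i \<ge> k" "j \<ge> k" for i j
    proof -
      have "(norm (U i - U j))\<^sup>2 \<le> 2 * (J (U i) - m) + 2 * (J (U j) - m)"
        by (rule parallelogram)
      also have "\<dots> < 2 * (e\<^sup>2 / 4) + 2 * (e\<^sup>2 / 4)"
        using small that by (intro add_strict_mono mult_strict_left_mono) auto
      finally have "(norm (U i - U j))\<^sup>2 < e\<^sup>2" by simp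
      then show ?thesis
        unfolding dist_norm by (rule power2_less_imp_less) (use e in simp)
    qed
    then show "\<exists>M. \<forall>i\<ge>M. \<forall>j\<ge>M. dist (U i) (U j) < e" by blast
  qed
  then obtain u where u: "U \<longlonglongrightarrow> u"
    using Cauchy_convergent convergent_def by blast
  have "(\<lambda>n. J (U n)) \<longlonglongrightarrow> J u"
    unfolding J_def by (intro tendsto_intros u g.tendsto)
  moreover have "(\<lambda>n. m + 1 / real (Suc n)) \<longlonglongrightarrow> m + 0"
    by (intro tendsto_intros LIMSEQ_Suc lim_1_over_n)
  ultimately have "J u \<le> m + 0"
    by (rule LIMSEQ_le) (use U less_imp_le in blast)
  then have "J u \<le> m" by simp
  have "rinner u v = g v" for v
  proof (rule ccontr)
    define d where "d = rinner u v - g v"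
    assume "rinner u v \<noteq> g v"
    then have d: "d \<noteq> 0" by (simp add: d_def)
    have v: "norm v > 0" using d by (auto simp: d_def g.zero)
    \<comment> \<open>This \<open>t\<close> minimises the quadratic that \<open>J\<close> becomes on
      the line through \<open>u\<close> in direction \<open>v\<close>; a nonzero \<open>d\<close>
      would push \<open>J\<close> strictly below its minimum.\<close>
    define t where "t = - d / (norm v)\<^sup>2"
    have "J u \<le> J (u + t *\<^sub>R v)"
      using \<open>J u \<le> m\<close> m_le order_trans by blast
    also have "\<dots> = J u + 2 * t * d + t\<^sup>2 * (norm v)\<^sup>2"
      unfolding J_def norm_add_sq d_def
      by (simp add: g.add g.scaleR rinner_scaleR_right power_mult_distrib algebra_simps)
    also have "\<dots> = J u - d\<^sup>2 / (norm v)\<^sup>2"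
      using v by (simp add: t_def power_divide power2_eq_square)
    finally show False using d v by (simp add: divide_le_0_iff)
  qed
  then show thesis by (rule that)
qed

text \<open>Real parts suffice: for \<open>v = u - u'\<close> the inner product of
  \<open>u - u'\<close> with itself is real, so it vanishes once its real part does.\<close>

lemma qinner_eqI:
  assumes "\<And>v. rinner (u::'a::quat_inner) v = rinner u' v"
  shows "u = u'"
proof -
  have "qinner (u - u') (u - u') = 0"
    using qinner_self_real[of "u - u'"] assms[of "u - u'"]
    by (simp add: quat_eq_iff quat_Reals_iff qinner_diff_left)
  then show ?thesis using qinner_self_zero by fastforce
qed

lemma right_linearD:
  assumes "right_linear T"
  shows "T (u + v) = T u + T v" "T (u *\<^sub>Q q) = T u *\<^sub>Q q" "T 0 = 0" "T (u - v) = T u - T v"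
proof -
  have *: "T (u *\<^sub>Q a + v *\<^sub>Q b) = T u *\<^sub>Q a + T v *\<^sub>Q b" for u v a b
    using assms by (simp add: right_linear_def)
  show add: "T (u + v) = T u + T v" for u v using *[of u 1 v 1] by (simp add: scaleQ_one)
  show "T (u *\<^sub>Q q) = T u *\<^sub>Q q" using *[of u q u 0] by simp
  show "T 0 = 0" using *[of 0 0 0 0] by simp
  show "T (u - v) = T u - T v" using add[of "u - v" v] by simp
qed

text \<open>If \<open>T\<close> were unbounded, there would be unit vectors \<open>y n\<close> with
  \<open>norm (T (y n))\<close> above \<open>n\<close>; no subsequence of these images is bounded,
  let alone convergent.\<close>

lemma compact_operator_bounded_linear:
  assumes "compact_operator (T::'a::quat_hilbert \<Rightarrow> 'a)"
  shows "bounded_linear T"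
proof -
  have lin: "right_linear T" using assms by (simp add: compact_operator_def)
  have scaleR: "T (r *\<^sub>R x) = r *\<^sub>R T x" for r x
    by (simp add: scaleR_scaleQ right_linearD[OF lin])
  have "\<exists>K. \<forall>x. norm (T x) \<le> norm x * K"
  proof (rule ccontr)
    assume "\<not> ?thesis"
    then have "\<exists>x. norm (T x) > norm x * real n" for n by (meson not_le)
    then obtain x where x: "norm (T (x n)) > norm (x n) * real n" for n by metis
    have nz: "norm (x n) > 0" for n
      using x[of n] right_linearD(3)[OF lin] by (cases "x n = 0") auto
    define y where "y n = inverse (norm (x n)) *\<^sub>R x n" for n
    have "norm (y n) = 1" for n using nz[of n] by (simp add: y_def)
    then have "bounded (range y)" by (auto simp: bounded_iff)
    then obtain r :: "nat \<Rightarrow> nat" where r: "strict_mono r" "convergent (T \<circ> y \<circ> r)"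
      using assms by (auto simp: compact_operator_def)
    then have "bounded (range (T \<circ> y \<circ> r))"
      by (metis Bseq_eq_bounded convergent_imp_Bseq)
    then obtain B where B: "norm (T (y (r n))) \<le> B" for n
      by (auto simp: bounded_iff)
    have "norm (T (y n)) > real n" for n
      using x[of n] nz[of n] by (simp add: y_def scaleR field_simps)
    then have "real (r n) < B" for n
      using B[of n] by (meson less_le_trans)
    moreover have "n \<le> r n" for n using r(1) by (rule seq_suble)
    ultimately have "real n < B" for n by (meson le_less_trans of_nat_mono)
    then show False using reals_Archimedean2[of B] less_asym by blast
  qed
  then obtain K where "\<And>x. norm (T x) \<le> norm x * K" by blast
  then show ?thesis
    using right_linearD(1)[OF lin] scaleR by (intro bounded_linear_intro)
qed

text \<open>Resolves the definite description. Riesz applied to the real part of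
  \<open>qinner w (T v)\<close> gives a candidate, and replacing \<open>v\<close> by
  \<open>v\<close> times an arbitrary quaternion recovers the full quaternionic identity.\<close>

lemma qinner_quat_adjoint:
  assumes lin: "right_linear (T::'a::quat_hilbert \<Rightarrow> 'a)" and "bounded_linear T"
  shows "qinner (quat_adjoint T u) v = qinner u (T v)"
proof -
  have "\<exists>s. \<forall>v. qinner s v = qinner w (T v)" for w
  proof -
    have "bounded_linear qRe"
      by (rule bounded_linear_intro[where K = 1]) (use qRe_le_norm in auto)
    then have "bounded_linear (\<lambda>v. rinner w (T v))"
      using bounded_linear_compose bounded_linear_qinner assms(2) by metis
    then obtain s where s: "\<And>v. rinner s v = rinner w (T v)"
      using riesz_representation by blast
    have "qinner s v = qinner w (T v)" for v
    proof (rule quat_eqI_qRe_mult)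
      show "qRe (qinner s v * q) = qRe (qinner w (T v) * q)" for q
        using s[of "v *\<^sub>Q q"] by (simp add: right_linearD[OF lin] qinner_scaleQ_right del: times_quat.simps)
    qed
    then show ?thesis by blast
  qed
  then obtain S where S: "\<forall>u v. qinner (S u) v = qinner u (T v)" by metis
  have "quat_adjoint T = S"
    unfolding quat_adjoint_def
  proof (rule the_equality)
    show "S' = S" if "\<forall>u v. qinner (S' u) v = qinner u (T v)" for S'
    proof (rule ext, rule qinner_eqI)
      show "rinner (S' u) v = rinner (S u) v" for u v using that S by simp
    qed
  qed (rule S)
  then show ?thesis using S by simp
qed

section \<open>Orthonormal sets\<close>

definition orthonormal :: "'a::quat_inner set \<Rightarrow> bool" where
  "orthonormal N \<longleftrightarrow> (\<forall>z\<in>N. \<forall>z'\<in>N. qinner z z' = (if z = z' then 1 else 0))"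

lemma orthonormalD:
  assumes "orthonormal N" "z \<in> N" "z' \<in> N"
  shows "qinner z z' = (if z = z' then 1 else 0)"
  using assms by (simp add: orthonormal_def)

lemma norm_orthonormal:
  assumes "orthonormal (N :: 'a::quat_hilbert set)" "z \<in> N"
  shows "norm z = 1"
  using orthonormalD[OF assms assms(2)] by (simp add: norm_qinner)

lemma norm_sq_sum_orthonormal:
  assumes N: "orthonormal (N :: 'a::quat_hilbert set)" and "finite F" "F \<subseteq> N"
  shows "(norm (\<Sum>z\<in>F. z *\<^sub>Q c z))\<^sup>2 = (\<Sum>z\<in>F. (norm (c z))\<^sup>2)"
  using assms(2,3)
proof (induction F)
  case (insert y F)
  have "qinner y z = 0" if "z \<in> F" for z
    using orthonormalD[OF N, of y z] insert that by auto
  then have "qinner y (\<Sum>z\<in>F. z *\<^sub>Q c z) = 0"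
    by (simp add: qinner_sum_right qinner_scaleQ_right)
  then show ?case
    using insert norm_orthonormal[OF N, of y]
    by (simp add: norm_add_sq qinner_scaleQ_left norm_scaleQ del: times_quat.simps)
qed simp

text \<open>Expand the squared norm of \<open>x - ?s\<close>, which is nonnegative; by Pythagoras,
  the cross term is twice the squared norm of \<open>?s\<close>.\<close>

lemma bessel_inequality:
  assumes N: "orthonormal (N :: 'a::quat_hilbert set)" and F: "finite F" "F \<subseteq> N"
  shows "(\<Sum>z\<in>F. (norm (qinner z x))\<^sup>2) \<le> (norm x)\<^sup>2"
proof -
  let ?s = "\<Sum>z\<in>F. z *\<^sub>Q qinner z x"
  have "rinner x (z *\<^sub>Q qinner z x) = (norm (qinner z x))\<^sup>2" for z
    unfolding qinner_scaleQ_right qinner_cnj[of x z] qcnj_mult_self by (simp del: of_real_power)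
  then have "rinner x ?s = (\<Sum>z\<in>F. (norm (qinner z x))\<^sup>2)"
    by (simp add: qinner_sum_right qRe_sum)
  moreover have "0 \<le> (norm (x - ?s))\<^sup>2" by simp
  ultimately show ?thesis
    unfolding norm_diff_sq norm_sq_sum_orthonormal[OF N F] by simp
qed

text \<open>By Pythagoras, the squared distance of two nested partial sums is a partial sum of the
  scalar series. The net of finite partial sums is therefore Cauchy, and completeness gives the
  limit.\<close>

lemma orthonormal_summable_on:
  assumes N: "orthonormal (N :: 'a::quat_hilbert set)"
    and summable: "(\<lambda>z. (norm (c z))\<^sup>2) summable_on N"
  shows "(\<lambda>z. z *\<^sub>Q c z) summable_on N"
proof -
  let ?f = "\<lambda>z. z *\<^sub>Q c z" and ?g = "\<lambda>z. (norm (c z))\<^sup>2"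
  obtain L where L: "(?g has_sum L) N"
    using summable by (auto simp: summable_on_def)
  have "\<exists>P. eventually P (finite_subsets_at_top N) \<and>
      (\<forall>F F'. P F \<and> P F' \<longrightarrow> dist (sum ?f F) (sum ?f F') < e)" if e: "e > 0" for e
  proof -
    \<comment> \<open>The extra factor 1/2 turns the non-strict approximation into a strict bound by
      \<open>(e / 2)\<close> squared; two such bounds then combine to \<open>e\<close>.\<close>
    have pos: "(e / 2)\<^sup>2 / 2 > 0" using e by simp
    then obtain F0 where F0: "finite F0" "F0 \<subseteq> N" "dist (sum ?g F0) L \<le> (e / 2)\<^sup>2 / 2"
      using has_sum_finite_approximation[OF L] by blast
    define P where "P F \<longleftrightarrow> finite F \<and> F0 \<subseteq> F \<and> F \<subseteq> N" for F
    have near: "dist (sum ?f F) (sum ?f F0) < e / 2" if F: "P F" for F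
    proof -
      have "sum ?g F \<le> L"
        using F has_sum_mono_neutral[OF has_sum_finite[of F ?g] L] by (auto simp: P_def)
      moreover have "L - (e / 2)\<^sup>2 / 2 \<le> sum ?g F0"
        using F0(3) unfolding dist_real_def by linarith
      moreover have "sum ?g (F - F0) = sum ?g F - sum ?g F0"
        using F by (simp add: P_def sum_diff)
      ultimately have "sum ?g (F - F0) \<le> (e / 2)\<^sup>2 / 2" by linarith
      then have "sum ?g (F - F0) < (e / 2)\<^sup>2" using pos by linarith
      moreover have "sum ?f F - sum ?f F0 = sum ?f (F - F0)"
        using F by (simp add: P_def sum_diff)
      moreover have "(norm (sum ?f (F - F0)))\<^sup>2 = sum ?g (F - F0)"
        by (rule norm_sq_sum_orthonormal[OF N]) (use F in \<open>auto simp: P_def\<close>)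
      ultimately have "(norm (sum ?f F - sum ?f F0))\<^sup>2 < (e / 2)\<^sup>2" by simp
      then show ?thesis
        unfolding dist_norm by (rule power2_less_imp_less) (use e in simp)
    qed
    have "eventually P (finite_subsets_at_top N)"
      unfolding eventually_finite_subsets_at_top using F0 by (auto simp: P_def)
    moreover have "dist (sum ?f F) (sum ?f F') < e" if "P F" "P F'" for F F'
      using near[OF that(1)] near[OF that(2)] by (metis dist_triangle_half_l)
    ultimately show ?thesis by blast
  qed
  then have "cauchy_filter (filtermap (sum ?f) (finite_subsets_at_top N))"
    by (simp add: cauchy_filter_metric_filtermap)
  then obtain y where "(sum ?f \<longlongrightarrow> y) (finite_subsets_at_top N)"
    using cauchy_filter_convergent by (auto simp: filterlim_def convergent_filter_iff)
  then show ?thesis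
    using summable_on_def has_sum_def by blast
qed

text \<open>Totality is the form that a maximality argument delivers. Conversely to the uniqueness
  of sums, Bessel makes the expansion of \<open>x\<close> converge to some \<open>y\<close>, and
  \<open>x - y\<close> is orthogonal to \<open>N\<close>.\<close>

lemma hilbert_basis_iff_total:
  "hilbert_basis (N :: 'a::quat_hilbert set) \<longleftrightarrow>
    orthonormal N \<and> (\<forall>x. (\<forall>z\<in>N. qinner z x = 0) \<longrightarrow> x = 0)"
proof (intro iffI conjI allI impI)
  assume *: "hilbert_basis N"
  then show "orthonormal N" by (simp add: hilbert_basis_def orthonormal_def)
  fix x assume "\<forall>z\<in>N. qinner z x = 0"
  then have "((\<lambda>z. z *\<^sub>Q qinner z x) has_sum 0) N" by (intro has_sum_0) simp
  moreover have "((\<lambda>z. z *\<^sub>Q qinner z x) has_sum x) N"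
    using * by (simp add: hilbert_basis_def)
  ultimately show "x = 0" by (rule has_sum_unique[symmetric])
next
  assume *: "orthonormal N \<and> (\<forall>x. (\<forall>z\<in>N. qinner z x = 0) \<longrightarrow> x = 0)"
  then have N: "orthonormal N" by blast
  have "((\<lambda>z. z *\<^sub>Q qinner z x) has_sum x) N" for x
  proof -
    have "(\<lambda>z. (norm (qinner z x))\<^sup>2) summable_on N"
    proof (rule nonneg_bounded_partial_sums_imp_summable_on)
      show "\<forall>\<^sub>F F in finite_subsets_at_top N. (\<Sum>z\<in>F. (norm (qinner z x))\<^sup>2) \<le> (norm x)\<^sup>2"
        by (rule eventually_finite_subsets_at_top_weakI) (rule bessel_inequality[OF N])
    qed simp
    then obtain y where y: "((\<lambda>z. z *\<^sub>Q qinner z x) has_sum y) N"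
      using orthonormal_summable_on[OF N, of "\<lambda>z. qinner z x"] unfolding summable_on_def by blast
    have "qinner w (x - y) = 0" if w: "w \<in> N" for w
    proof -
      have "((\<lambda>z. qinner w (z *\<^sub>Q qinner z x)) has_sum qinner w y) N"
        by (rule has_sum_bounded_linear[OF bounded_linear_qinner y])
      \<comment> \<open>Orthogonality kills every summand except the one at
        \<open>w\<close>.\<close>
      moreover have "((\<lambda>z. qinner w (z *\<^sub>Q qinner z x)) has_sum qinner w x) N
          \<longleftrightarrow> ((\<lambda>z. qinner w x) has_sum qinner w x) {w}"
        by (rule has_sum_cong_neutral)
          (use w orthonormalD[OF N w] in \<open>auto simp: qinner_scaleQ_right\<close>)
      moreover have "((\<lambda>z. qinner w x) has_sum qinner w x) {w}"
        by (rule has_sum_finiteI) simp_all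
      ultimately have "qinner w y = qinner w x"
        by (blast intro: has_sum_unique)
      then show ?thesis by (simp add: qinner_diff_right)
    qed
    then have "x - y = 0" using * by blast
    then have "x = y" by simp
    then show ?thesis using y by simp
  qed
  then show "hilbert_basis N" using N by (simp add: hilbert_basis_def orthonormal_def)
qed

lemma infinite_hilbert_basis:
  assumes "hilbert_basis (N :: 'a::quat_hilbert set)" "\<not> finite_dimensional_quat TYPE('a)"
  shows "infinite N"
proof
  assume "finite N"
  have "x = (\<Sum>z\<in>N. z *\<^sub>Q qinner z x)" for x
  proof (rule has_sum_unique)
    show "((\<lambda>z. z *\<^sub>Q qinner z x) has_sum x) N"
      using assms(1) by (simp add: hilbert_basis_def)
  qed (rule has_sum_finite[OF \<open>finite N\<close>])
  then have "\<exists>c. x = (\<Sum>z\<in>N. z *\<^sub>Q c z)" for x by (rule exI[of _ "\<lambda>z. qinner z x"])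
  then show False using assms(2) \<open>finite N\<close> unfolding finite_dimensional_quat_def by blast
qed

section \<open>Eigenvectors of compact normal operators\<close>

definition closed_qsubspace :: "'a::quat_hilbert set \<Rightarrow> bool" where
  "closed_qsubspace M \<longleftrightarrow> closed M \<and> 0 \<in> M \<and> (\<forall>u\<in>M. \<forall>v\<in>M. u + v \<in> M) \<and> (\<forall>u\<in>M. \<forall>q. u *\<^sub>Q q \<in> M)"

lemma closed_qsubspaceD:
  assumes "closed_qsubspace M" "u \<in> M"
  shows "u *\<^sub>Q q \<in> M" "r *\<^sub>R u \<in> M" "v \<in> M \<Longrightarrow> u + v \<in> M" "v \<in> M \<Longrightarrow> u - v \<in> M"
proof -
  show q: "u *\<^sub>Q q \<in> M" "r *\<^sub>R u \<in> M" and "v \<in> M \<Longrightarrow> u + v \<in> M"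
    using assms by (auto simp: closed_qsubspace_def scaleR_scaleQ)
  assume "v \<in> M"
  then have "u + v *\<^sub>Q (- 1) \<in> M" using assms unfolding closed_qsubspace_def by blast
  then show "u - v \<in> M" by (simp add: scaleQ_one)
qed

text \<open>The adjoint is an abstract parameter, so that the locale can be instantiated again with
  the self-adjoint operator \<open>T + S\<close> in both places.\<close>

locale compact_normal =
  fixes T S :: "'a::quat_hilbert \<Rightarrow> 'a"
  assumes compact: "compact_operator T"
    and adjoint: "\<And>u v. qinner (S u) v = qinner u (T v)"
    and commute: "\<And>u. T (S u) = S (T u)"
begin

lemma adjoint': "qinner (T u) v = qinner u (S v)"
  by (metis adjoint qinner_cnj)

lemma linear: "right_linear T"
  using compact by (simp add: compact_operator_def)

lemma linear_adjoint: "right_linear S"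
  unfolding right_linear_def
proof (intro allI, rule qinner_eqI)
  show "rinner (S (u *\<^sub>Q a + v *\<^sub>Q b)) w = rinner (S u *\<^sub>Q a + S v *\<^sub>Q b) w" for u v a b w
    by (simp only: adjoint qinner_add_left qinner_scaleQ_left)
qed

lemmas T_simps = right_linearD[OF linear]
lemmas S_simps = right_linearD[OF linear_adjoint]

lemma T_scaleR: "T (r *\<^sub>R u) = r *\<^sub>R T u"
  by (simp add: scaleR_scaleQ T_simps)

lemma S_scaleR: "S (r *\<^sub>R u) = r *\<^sub>R S u"
  by (simp add: scaleR_scaleQ S_simps)

text \<open>Both squared norms equal the inner product of \<open>u\<close> with
  \<open>S (T u)\<close>, by normality.\<close>

lemma norm_adjoint: "norm (S u) = norm (T u)"
  by (simp add: norm_qinner adjoint adjoint' commute)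

text \<open>By \<open>norm_adjoint\<close> and linearity, \<open>S\<close> and \<open>T\<close>
  induce the same distances between images, so a subsequence that serves \<open>T\<close> also
  serves \<open>S\<close>.\<close>

lemma compact_adjoint: "compact_operator S"
  unfolding compact_operator_def
proof (intro conjI allI impI linear_adjoint)
  fix x :: "nat \<Rightarrow> 'a" assume "bounded (range x)"
  then obtain r :: "nat \<Rightarrow> nat" where r: "strict_mono r" "convergent (T \<circ> x \<circ> r)"
    using compact by (auto simp: compact_operator_def)
  have "dist (S u) (S v) = dist (T u) (T v)" for u v
    unfolding dist_norm by (metis S_simps(4) T_simps(4) norm_adjoint)
  then have "Cauchy (S \<circ> x \<circ> r)"
    using convergent_Cauchy[OF r(2)] by (simp add: Cauchy_def)
  then show "\<exists>r::nat \<Rightarrow> nat. strict_mono r \<and> convergent (S \<circ> x \<circ> r)"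
    using r(1) Cauchy_convergent by blast
qed

lemma bounded_linear_T: "bounded_linear T"
  using compact by (rule compact_operator_bounded_linear)

lemma bounded_linear_S: "bounded_linear S"
  using compact_adjoint by (rule compact_operator_bounded_linear)

lemma compact_normal_sum: "compact_normal (\<lambda>u. T u + S u) (\<lambda>u. T u + S u)"
proof
  show "compact_operator (\<lambda>u. T u + S u)"
    unfolding compact_operator_def
  proof (intro conjI allI impI)
    show "right_linear (\<lambda>u. T u + S u)"
      by (simp add: right_linear_def T_simps S_simps scaleQ_add_left algebra_simps)
    fix x :: "nat \<Rightarrow> 'a" assume x: "bounded (range x)"
    then obtain r :: "nat \<Rightarrow> nat" where r: "strict_mono r" "convergent (T \<circ> x \<circ> r)"
      using compact by (auto simp: compact_operator_def)
    have "bounded (range (x \<circ> r))"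
      by (rule bounded_subset[OF x]) auto
    then obtain s :: "nat \<Rightarrow> nat" where s: "strict_mono s" "convergent (S \<circ> (x \<circ> r) \<circ> s)"
      using compact_adjoint unfolding compact_operator_def by blast
    have "convergent (T \<circ> x \<circ> r \<circ> s)"
      using r(2) s(1) convergent_subseq_convergent by blast
    then have "convergent (\<lambda>n. (T \<circ> x \<circ> r \<circ> s) n + (S \<circ> (x \<circ> r) \<circ> s) n)"
      using s(2) by (rule convergent_add)
    then have "convergent ((\<lambda>u. T u + S u) \<circ> x \<circ> (r \<circ> s))"
      by (simp add: o_def)
    then show "\<exists>r::nat \<Rightarrow> nat. strict_mono r \<and> convergent ((\<lambda>u. T u + S u) \<circ> x \<circ> r)"
      using r(1) s(1) strict_mono_o by blast
  qed
qed (simp_all add: qinner_add_left qinner_add_right adjoint adjoint' add.commute)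

text \<open>The constant \<open>c\<close> is the operator norm of the restriction of \<open>T\<close> to \<open>M\<close>, and the
  eigenvector is the limit of a sequence of unit vectors along which \<open>norm (T u)\<close> tends to \<open>c\<close>.\<close>

lemma exists_singular_vector:
  assumes M: "closed_qsubspace M" "M \<noteq> {0}" and inv: "\<And>u. u \<in> M \<Longrightarrow> T u \<in> M"
  obtains u c where "u \<in> M" "u \<noteq> 0" "c \<ge> 0" "S (T u) = c\<^sup>2 *\<^sub>R u"
proof -
  define U where "U = {u\<in>M. norm u = 1}"
  obtain u0 where u0: "u0 \<in> M" "u0 \<noteq> 0" using M by (auto simp: closed_qsubspace_def)
  have normalise: "inverse (norm u) *\<^sub>R u \<in> U" if "u \<in> M" "u \<noteq> 0" for u
    using that closed_qsubspaceD(2)[OF M(1)] by (simp add: U_def)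
  have "U \<noteq> {}" using normalise u0 by blast
  interpret T: bounded_linear T by (rule bounded_linear_T)
  interpret S: bounded_linear S by (rule bounded_linear_S)
  obtain K where K: "\<And>u. norm (T u) \<le> norm u * K" using T.bounded by blast
  define c where "c = (SUP u\<in>U. norm (T u))"
  have bdd: "bdd_above ((\<lambda>u. norm (T u)) ` U)"
    using K by (intro bdd_aboveI2[where M = K]) (metis (mono_tags) U_def mem_Collect_eq mult_1)
  have le_U: "norm (T u) \<le> c" if "u \<in> U" for u
    unfolding c_def using that bdd by (rule cSUP_upper)
  have le: "norm (T u) \<le> c * norm u" if "u \<in> M" for u
  proof (cases "u = 0")
    case False
    then show ?thesis
      using le_U[OF normalise[OF that]] by (simp add: T_scaleR field_simps)
  qed (simp add: T.zero)
  have "c \<ge> 0" using le_U \<open>U \<noteq> {}\<close> by (meson all_not_in_conv norm_ge_zero order_trans)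
  show thesis
  proof (cases "c = 0")
    \<comment> \<open>Here \<open>T\<close> vanishes on all of \<open>M\<close>, so any nonzero
      vector of \<open>M\<close> serves.\<close>
    case True
    then have "T u0 = 0" using le[OF u0(1)] by simp
    then show thesis using that[of u0 0] u0 by (simp add: S.zero)
  next
    case False
    then have c: "c > 0" using \<open>c \<ge> 0\<close> by simp
    have "\<exists>u\<in>U. c - 1 / real (Suc n) < norm (T u)" for n
      using less_cSUP_iff[OF \<open>U \<noteq> {}\<close> bdd, of "c - 1 / real (Suc n)"] by (simp add: c_def)
    then obtain x where x: "\<And>n. x n \<in> U" "\<And>n. c - 1 / real (Suc n) < norm (T (x n))" by metis
    have "(\<lambda>n. c - 1 / real (Suc n)) \<longlonglongrightarrow> c - 0"
      by (intro tendsto_intros LIMSEQ_Suc lim_1_over_n)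
    then have lower: "(\<lambda>n. c - 1 / real (Suc n)) \<longlonglongrightarrow> c" by simp
    have Tx: "(\<lambda>n. norm (T (x n))) \<longlonglongrightarrow> c"
    proof (rule tendsto_sandwich[OF _ _ lower tendsto_const])
      show "\<forall>\<^sub>F n in sequentially. c - 1 / real (Suc n) \<le> norm (T (x n))"
        by (intro always_eventually allI less_imp_le x(2))
      show "\<forall>\<^sub>F n in sequentially. norm (T (x n)) \<le> c"
        by (intro always_eventually allI le_U x(1))
    qed
    \<comment> \<open>The defect of \<open>x n\<close> as an eigenvector of \<open>S\<close> after
      \<open>T\<close> for the square of \<open>c\<close>; expanding its squared norm shows that it
      tends to 0.\<close>
    define y where "y n = S (T (x n)) - c\<^sup>2 *\<^sub>R x n" for n
    have y_le: "(norm (y n))\<^sup>2 \<le> c^4 - c\<^sup>2 * (norm (T (x n)))\<^sup>2" for n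
    proof -
      have xn: "x n \<in> M" "norm (x n) = 1" using x(1)[of n] by (auto simp: U_def)
      have "norm (S (T (x n))) \<le> c * norm (T (x n))"
        unfolding norm_adjoint using le inv xn by blast
      then have "(norm (S (T (x n))))\<^sup>2 \<le> (c * norm (T (x n)))\<^sup>2"
        by (intro power_mono) simp_all
      moreover have "rinner (S (T (x n))) (c\<^sup>2 *\<^sub>R x n) = c\<^sup>2 * (norm (T (x n)))\<^sup>2"
        by (simp add: rinner_scaleR_right adjoint norm_sq_rinner T_scaleR)
      ultimately show ?thesis
        unfolding y_def norm_diff_sq using xn by (simp add: power_mult_distrib)
    qed
    have "(\<lambda>n. c^4 - c\<^sup>2 * (norm (T (x n)))\<^sup>2) \<longlonglongrightarrow> c^4 - c\<^sup>2 * c\<^sup>2"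
      by (intro tendsto_intros Tx)
    then have upper: "(\<lambda>n. c^4 - c\<^sup>2 * (norm (T (x n)))\<^sup>2) \<longlonglongrightarrow> 0" by (simp add: power_add[symmetric])
    have "(\<lambda>n. (norm (y n))\<^sup>2) \<longlonglongrightarrow> 0"
    proof (rule tendsto_sandwich[OF _ _ tendsto_const upper])
      show "\<forall>\<^sub>F n in sequentially. 0 \<le> (norm (y n))\<^sup>2" by simp
      show "\<forall>\<^sub>F n in sequentially. (norm (y n))\<^sup>2 \<le> c^4 - c\<^sup>2 * (norm (T (x n)))\<^sup>2"
        by (intro always_eventually allI y_le)
    qed
    then have "(\<lambda>n. sqrt ((norm (y n))\<^sup>2)) \<longlonglongrightarrow> sqrt 0"
      by (rule tendsto_real_sqrt)
    then have y: "y \<longlonglongrightarrow> 0" by (simp add: tendsto_norm_zero_iff)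
    have "bounded (range x)" using x(1) by (auto simp: bounded_iff U_def)
    then obtain r :: "nat \<Rightarrow> nat" where r: "strict_mono r" "convergent (T \<circ> x \<circ> r)"
      using compact by (auto simp: compact_operator_def)
    then obtain w where w: "(\<lambda>n. T (x (r n))) \<longlonglongrightarrow> w"
      by (auto simp: convergent_def o_def)
    have yr: "(\<lambda>n. y (r n)) \<longlonglongrightarrow> 0"
      using LIMSEQ_subseq_LIMSEQ[OF y r(1)] by (simp add: o_def)
    \<comment> \<open>Solving the definition of \<open>y\<close> for \<open>x n\<close> expresses it
      through \<open>S (T (x n))\<close> and \<open>y n\<close>, so convergence of
      \<open>T (x (r n))\<close> forces \<open>x (r n)\<close> to converge to this
      \<open>u\<close>.\<close>
    define u where "u = inverse (c\<^sup>2) *\<^sub>R S w"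
    have "(\<lambda>n. inverse (c\<^sup>2) *\<^sub>R (S (T (x (r n))) - y (r n))) \<longlonglongrightarrow> inverse (c\<^sup>2) *\<^sub>R (S w - 0)"
      by (intro tendsto_intros S.tendsto w yr)
    then have u: "(\<lambda>n. x (r n)) \<longlonglongrightarrow> u"
      using c by (simp add: y_def u_def)
    have "u \<in> M"
      using M(1) closed_sequentially[OF _ _ u] x(1) by (auto simp: closed_qsubspace_def U_def)
    moreover have "norm u = 1"
      using LIMSEQ_unique[OF tendsto_norm[OF u], of 1] x(1) by (simp add: U_def)
    moreover have "S (T u) = c\<^sup>2 *\<^sub>R u"
    proof (rule LIMSEQ_unique)
      show "(\<lambda>n. S (T (x (r n)))) \<longlonglongrightarrow> S (T u)"
        by (intro S.tendsto T.tendsto u)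
      show "(\<lambda>n. S (T (x (r n)))) \<longlonglongrightarrow> c\<^sup>2 *\<^sub>R u"
        using c S.tendsto[OF w] by (simp add: u_def)
    qed
    ultimately show thesis using that[of u c] \<open>c \<ge> 0\<close> by force
  qed
qed

text \<open>On a simultaneous eigenspace of \<open>S \<circ> T\<close> and \<open>T + S\<close>, with eigenvalues \<open>c\<^sup>2\<close> and \<open>a\<close>,
  the operator \<open>T\<close> is a root of the real polynomial \<open>X\<^sup>2 - a X + c\<^sup>2\<close>, which is the characteristic
  polynomial of a quaternion \<open>q\<close> because \<open>\<bar>a\<bar> \<le> 2 c\<close>.\<close>

lemma exists_eigenvector:
  assumes M: "closed_qsubspace M" "M \<noteq> {0}"
    and invT: "\<And>u. u \<in> M \<Longrightarrow> T u \<in> M" and invS: "\<And>u. u \<in> M \<Longrightarrow> S u \<in> M"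
  obtains u q where "u \<in> M" "eigenvector T u q"
proof -
  obtain u0 c where u0: "u0 \<in> M" "u0 \<noteq> 0" "c \<ge> 0" "S (T u0) = c\<^sup>2 *\<^sub>R u0"
    using exists_singular_vector[OF M invT] by blast
  define E where "E = {u\<in>M. S (T u) = c\<^sup>2 *\<^sub>R u}"
  have "E = M \<inter> {u. S (T u) = c\<^sup>2 *\<^sub>R u}" by (auto simp: E_def)
  moreover have "closed {u. S (T u) = c\<^sup>2 *\<^sub>R u}"
    by (intro closed_Collect_eq continuous_intros
        bounded_linear.continuous_on[OF bounded_linear_S] bounded_linear.continuous_on[OF bounded_linear_T])
  ultimately have "closed E" using M(1) by (auto simp: closed_qsubspace_def)
  then have E: "closed_qsubspace E"
    using M(1) unfolding closed_qsubspace_def E_def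
    by (auto simp: T_simps S_simps scaleQ_add_left scaleR_scaleQ scaleQ_scaleQ quat_of_real_commute
        simp del: of_real_power)
  have "u0 \<in> E" using u0 by (simp add: E_def)
  have ET: "T u \<in> E" if "u \<in> E" for u
    using that invT by (simp add: E_def commute[symmetric] T_scaleR[symmetric])
  have ES: "S u \<in> E" if "u \<in> E" for u
    using that invS by (simp add: E_def commute S_scaleR)
  interpret A: compact_normal "\<lambda>u. T u + S u" "\<lambda>u. T u + S u" by (rule compact_normal_sum)
  define A where "A u = T u + S u" for u
  have EA: "A u \<in> E" if "u \<in> E" for u
    using that ET ES closed_qsubspaceD(3)[OF E] by (simp add: A_def)
  obtain u1 d where u1: "u1 \<in> E" "u1 \<noteq> 0" "A (A u1) = d\<^sup>2 *\<^sub>R u1"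
  proof (rule A.exists_singular_vector[OF E, folded A_def])
    show "E \<noteq> {0}" using \<open>u0 \<in> E\<close> u0(2) by blast
  qed (rule EA)
  \<comment> \<open>From \<open>(A - d) (A + d) u1 = 0\<close>: either \<open>u1\<close> has
    eigenvalue \<open>- d\<close>, or \<open>A u1 + d u1\<close> is a nonzero eigenvector for
    \<open>d\<close>.\<close>
  obtain e a where e: "e \<in> E" "e \<noteq> 0" "A e = a *\<^sub>R e"
  proof (cases "A u1 + d *\<^sub>R u1 = 0")
    case True
    then have "A u1 = (- d) *\<^sub>R u1" by (simp add: add_eq_0_iff2)
    then show thesis using that u1 by blast
  next
    case False
    have "A (A u1 + d *\<^sub>R u1) = d *\<^sub>R (A u1 + d *\<^sub>R u1)"
      using u1(3) A.T_simps(1) A.T_scaleR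
      by (simp add: A_def[symmetric] scaleR_add_right power2_eq_square)
    moreover have "A u1 + d *\<^sub>R u1 \<in> E"
      using u1(1) EA closed_qsubspaceD(2,3)[OF E] by blast
    ultimately show thesis using that False by blast
  qed
  have eE: "S (T e) = c\<^sup>2 *\<^sub>R e" "e \<in> M" using e(1) by (auto simp: E_def)
  have "S e = a *\<^sub>R e - T e" using e(3) by (simp add: A_def algebra_simps)
  then have "T (S e) = a *\<^sub>R T e - T (T e)" by (simp add: T_simps T_scaleR)
  then have TT: "T (T e) = a *\<^sub>R T e - c\<^sup>2 *\<^sub>R e"
    using eE(1) commute[of e] by (simp add: algebra_simps)
  \<comment> \<open>With \<open>norm (S e) = norm (T e) = c * norm e\<close>, the triangle
    inequality for \<open>T e + S e = a e\<close> bounds \<open>a\<close>, which makes the square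
    root in \<open>q\<close> real.\<close>
  have "(norm (T e))\<^sup>2 = (c * norm e)\<^sup>2"
    using eE(1) by (simp add: norm_sq_rinner adjoint' rinner_scaleR_right power_mult_distrib)
  then have "norm (T e) = c * norm e"
    using u0(3) by (simp add: power2_eq_iff_nonneg)
  then have "\<bar>a\<bar> * norm e \<le> 2 * c * norm e"
    using norm_triangle_ineq[of "T e" "S e"] e(3) by (simp add: A_def norm_adjoint)
  then have "\<bar>a\<bar> \<le> 2 * c" using e(2) by simp
  then have "a\<^sup>2 \<le> (2 * c)\<^sup>2" using abs_le_square_iff[of a "2 * c"] u0(3) by simp
  then have disc: "c\<^sup>2 - (a / 2)\<^sup>2 \<ge> 0" by (simp add: power_divide power_mult_distrib)
  define q where "q = Quat (a / 2) (sqrt (c\<^sup>2 - (a / 2)\<^sup>2)) 0 0"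
  have tr: "of_real a = q + qcnj q" by (simp add: q_def quat_eq_iff)
  have nrm: "of_real (c\<^sup>2) = qcnj q * q"
    using disc by (simp add: q_def quat_eq_iff power2_eq_square[symmetric] del: of_real_power)
  \<comment> \<open>The quadratic relation for \<open>T\<close> on \<open>e\<close> factors through
    right multiplication by \<open>qcnj q\<close> and then \<open>q\<close>. So either
    \<open>v\<close> is an eigenvector for \<open>q\<close>, or \<open>v = 0\<close> and
    \<open>e\<close> is one for \<open>qcnj q\<close>.\<close>
  define v where "v = T e - e *\<^sub>Q qcnj q"
  have "T v = T e *\<^sub>Q (q + qcnj q) - e *\<^sub>Q (qcnj q * q) - T e *\<^sub>Q qcnj q"
    by (simp only: v_def T_simps TT scaleR_scaleQ tr nrm)
  also have "\<dots> = v *\<^sub>Q q"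
    by (simp add: v_def scaleQ_add_right scaleQ_diff_left scaleQ_scaleQ)
  finally have "T v = v *\<^sub>Q q" .
  moreover have "v \<in> M"
    using eE(2) invT closed_qsubspaceD(1,4)[OF M(1)] by (simp add: v_def)
  moreover have "T e = e *\<^sub>Q qcnj q" if "v = 0" using that by (simp add: v_def)
  ultimately show thesis
    using that eE(2) e(2) unfolding eigenvector_def by metis
qed

text \<open>In the squared norm of \<open>S z - z *\<^sub>Q qcnj q\<close>, both squared norms and
  the inner product \<open>rinner\<close> equal the product of the squared norms of \<open>z\<close>
  and \<open>q\<close>, so everything cancels.\<close>

lemma adjoint_eigenvector:
  assumes "T z = z *\<^sub>Q q"
  shows "S z = z *\<^sub>Q qcnj q"
proof -
  have "rinner (S z) (z *\<^sub>Q qcnj q) = qRe (qinner z z * (q * qcnj q))"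
    by (simp only: adjoint T_simps assms qinner_scaleQ_right mult.assoc)
  also have "\<dots> = (norm z)\<^sup>2 * (norm q)\<^sup>2"
    unfolding qinner_self mult_qcnj_self by (simp only: of_real_mult[symmetric] quat_of_real_sel)
  finally have "(norm (S z - z *\<^sub>Q qcnj q))\<^sup>2 = 0"
    unfolding norm_diff_sq norm_adjoint assms by (simp add: norm_scaleQ power_mult_distrib)
  then show ?thesis by simp
qed

text \<open>Zorn's lemma gives a maximal orthonormal set of eigenvectors; an eigenvector in its
  orthogonal complement would enlarge it. For a unit eigenvector the eigenvalue is recovered as
  \<open>qinner z (T z)\<close>.\<close>

lemma exists_eigenbasis:
  obtains N where "hilbert_basis N" "\<And>z. z \<in> N \<Longrightarrow> eigenvector T z (qinner z (T z))"
proof -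
  define \<A> where "\<A> = {N. orthonormal N \<and> (\<forall>z\<in>N. \<exists>q. T z = z *\<^sub>Q q)}"
  have "\<exists>N\<in>\<A>. \<forall>X\<in>\<A>. N \<subseteq> X \<longrightarrow> X = N"
  proof (rule subset_Zorn')
    fix C assume C: "subset.chain \<A> C"
    have "orthonormal (\<Union>C)"
      unfolding orthonormal_def
    proof (intro ballI)
      fix z z' assume "z \<in> \<Union>C" "z' \<in> \<Union>C"
      then obtain X where "X \<in> C" "z \<in> X" "z' \<in> X"
        using C unfolding subset_chain_def by blast
      then show "qinner z z' = (if z = z' then 1 else 0)"
        using C orthonormalD unfolding subset_chain_def \<A>_def by blast
    qed
    then show "\<Union>C \<in> \<A>" using C by (auto simp: \<A>_def subset_chain_def)
  qed
  then obtain N where "N \<in> \<A>" and max: "\<And>X. X \<in> \<A> \<Longrightarrow> N \<subseteq> X \<Longrightarrow> X = N"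
    by blast
  then have N: "orthonormal N" "\<And>z. z \<in> N \<Longrightarrow> \<exists>q. T z = z *\<^sub>Q q"
    by (auto simp: \<A>_def)
  define M where "M = {x. \<forall>z\<in>N. qinner z x = 0}"
  have "closed {x. qinner z x = 0}" for z :: 'a
    by (intro closed_Collect_eq continuous_intros bounded_linear.continuous_on[OF bounded_linear_qinner])
  moreover have "M = (\<Inter>z\<in>N. {x. qinner z x = 0})" by (auto simp: M_def)
  ultimately have "closed M" by auto
  then have M: "closed_qsubspace M"
    by (auto simp: closed_qsubspace_def M_def qinner_add_right qinner_scaleQ_right)
  have invT: "T x \<in> M" if "x \<in> M" for x
    unfolding M_def
  proof safe
    fix z assume z: "z \<in> N"
    then obtain q where "T z = z *\<^sub>Q q" using N(2) by blast
    then have "S z = z *\<^sub>Q qcnj q" by (rule adjoint_eigenvector)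
    then show "qinner z (T x) = 0"
      using that z by (simp add: adjoint[symmetric] qinner_scaleQ_left M_def)
  qed
  have invS: "S x \<in> M" if "x \<in> M" for x
    unfolding M_def
  proof safe
    fix z assume z: "z \<in> N"
    then obtain q where "T z = z *\<^sub>Q q" using N(2) by blast
    then show "qinner z (S x) = 0"
      using that z by (simp add: adjoint'[symmetric] qinner_scaleQ_left M_def)
  qed
  have "M = {0}"
  proof (rule ccontr)
    assume "M \<noteq> {0}"
    then obtain u q where u: "u \<in> M" "eigenvector T u q"
      using exists_eigenvector[OF M _ invT invS] by blast
    then have u0: "u \<noteq> 0" "T u = u *\<^sub>Q q" by (auto simp: eigenvector_def)
    \<comment> \<open>Scaling by a real number keeps the eigenvalue \<open>q\<close>, whereas a
      general quaternionic factor would conjugate it.\<close>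
    define w where "w = inverse (norm u) *\<^sub>R u"
    have w: "norm w = 1" "w \<in> M"
      using u0 u(1) closed_qsubspaceD(2)[OF M] by (auto simp: w_def)
    have "T w = w *\<^sub>Q q"
      unfolding w_def T_scaleR u0(2) by (simp only: scaleR_scaleQ scaleQ_scaleQ quat_of_real_commute)
    moreover have ww: "qinner w w = 1" using w(1) by (simp add: qinner_self)
    have "w \<notin> N" using ww w(2) by (auto simp: M_def)
    moreover have "qinner z w = 0" "qinner w z = 0" if "z \<in> N" for z
      using that w(2) qinner_cnj[of w z] by (auto simp: M_def quat_eq_iff)
    ultimately have "insert w N \<in> \<A>"
      using N ww by (auto simp: \<A>_def orthonormal_def)
    then show False using max \<open>w \<notin> N\<close> by blast
  qed
  then have "hilbert_basis N"
    unfolding hilbert_basis_iff_total using N(1) by (auto simp: M_def)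
  moreover have "eigenvector T z (qinner z (T z))" if z: "z \<in> N" for z
  proof -
    obtain q where q: "T z = z *\<^sub>Q q" using N(2)[OF z] by blast
    have "qinner z z = 1" using orthonormalD[OF N(1) z z] by simp
    then have "z \<noteq> 0" "qinner z (T z) = q" by (auto simp: q qinner_scaleQ_right)
    then show ?thesis using q by (simp add: eigenvector_def)
  qed
  ultimately show thesis by (rule that)
qed

end

section \<open>Size and accumulation of the eigenvalues, and the spherical spectrum\<close>

lemma compact_normal_adjoint:
  assumes "compact_operator T" "normal_operator T"
  shows "compact_normal T (quat_adjoint T)"
proof
  show "qinner (quat_adjoint T u) v = qinner u (T v)" for u v
    using assms(1) compact_operator_bounded_linear[OF assms(1)]
    by (intro qinner_quat_adjoint) (auto simp: compact_operator_def)
  show "T (quat_adjoint T u) = quat_adjoint T (T u)" for u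
    using assms(2) unfolding normal_operator_def by (metis comp_apply)
qed (rule assms(1))

text \<open>The images of distinct elements of the set below are at distance at least \<open>\<epsilon>\<close>, so an infinite
  set would contradict compactness.\<close>

lemma finite_large_eigenvalues:
  assumes T: "compact_operator (T :: 'a::quat_hilbert \<Rightarrow> 'a)" and N: "orthonormal N"
    and eig: "\<And>z. z \<in> N \<Longrightarrow> T z = z *\<^sub>Q lam z" and "\<epsilon> > 0"
  shows "finite {z\<in>N. \<epsilon> \<le> norm (lam z)}"
proof (rule ccontr)
  assume "infinite {z\<in>N. \<epsilon> \<le> norm (lam z)}"
  then obtain x :: "nat \<Rightarrow> 'a" where x: "inj x" "range x \<subseteq> {z\<in>N. \<epsilon> \<le> norm (lam z)}"
    using infinite_countable_subset by blast
  then have xN: "x n \<in> N" "\<epsilon> \<le> norm (lam (x n))" for n by auto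
  then have "bounded (range x)"
    using norm_orthonormal[OF N] by (auto simp: bounded_iff)
  then obtain r :: "nat \<Rightarrow> nat" where r: "strict_mono r" "convergent (T \<circ> x \<circ> r)"
    using T by (auto simp: compact_operator_def)
  obtain k where "\<And>i j. i \<ge> k \<Longrightarrow> j \<ge> k \<Longrightarrow> dist ((T \<circ> x \<circ> r) i) ((T \<circ> x \<circ> r) j) < \<epsilon>"
    using convergent_Cauchy[OF r(2)] \<open>\<epsilon> > 0\<close> unfolding Cauchy_def by blast
  then have "norm (T (x (r (Suc k))) - T (x (r k))) < \<epsilon>"
    by (simp add: dist_norm)
  then have "(norm (T (x (r (Suc k))) - T (x (r k))))\<^sup>2 < \<epsilon>\<^sup>2"
    by (intro power_strict_mono) simp_all
  moreover have "x (r (Suc k)) \<noteq> x (r k)"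
    using x(1) strict_monoD[OF r(1), of k "Suc k"] by (auto dest: injD)
  then have "qinner (x (r (Suc k))) (x (r k)) = 0"
    using orthonormalD[OF N xN(1) xN(1)] by simp
  ultimately have "(norm (lam (x (r (Suc k)))))\<^sup>2 + (norm (lam (x (r k))))\<^sup>2 < \<epsilon>\<^sup>2"
    unfolding norm_diff_sq
    by (simp add: eig xN norm_scaleQ norm_orthonormal[OF N] qinner_scaleQ_left qinner_scaleQ_right
        del: times_quat.simps)
  moreover have "\<epsilon>\<^sup>2 \<le> (norm (lam (x (r k))))\<^sup>2"
    using xN(2) \<open>\<epsilon> > 0\<close> by (intro power_mono) auto
  ultimately show False by (smt (verit) zero_le_power2)
qed

text \<open>At \<open>q = 0\<close> the operator \<open>Delta\<close> is the square of
  \<open>T\<close>. A bounded inverse would keep all \<open>lam z\<close> away from 0, which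
  \<open>finite_large_eigenvalues\<close> forbids for infinite \<open>N\<close>.\<close>

lemma zero_in_spherical_spectrum:
  assumes T: "compact_operator (T :: 'a::quat_hilbert \<Rightarrow> 'a)" and N: "orthonormal N" "infinite N"
    and eig: "\<And>z. z \<in> N \<Longrightarrow> T z = z *\<^sub>Q lam z"
  shows "0 \<in> spherical_spectrum T"
proof (rule ccontr)
  assume "0 \<notin> spherical_spectrum T"
  then have ker: "{u. Delta T 0 u = 0} = {0}"
    and "\<exists>K\<ge>0. \<forall>y\<in>range (Delta T 0). norm (inv (Delta T 0) y) \<le> K * norm y"
    by (auto simp: spherical_spectrum_def spherical_resolvent_def)
  then obtain K where K: "K \<ge> 0" "\<forall>y\<in>range (Delta T 0). norm (inv (Delta T 0) y) \<le> K * norm y"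
    by blast
  have "qcnj 0 = 0" by (simp add: quat_eq_iff)
  then have D: "Delta T 0 u = T (T u)" for u by (simp add: Delta_def)
  have lin: "right_linear T" using T by (simp add: compact_operator_def)
  have inj: "inj (Delta T 0)"
  proof (rule injI)
    fix u v assume "Delta T 0 u = Delta T 0 v"
    then have "Delta T 0 (u - v) = 0" by (simp add: D right_linearD[OF lin])
    then have "u - v \<in> {0}" by (simp flip: ker)
    then show "u = v" by simp
  qed
  then have bound: "norm x \<le> K * norm (T (T x))" for x
    using bspec[OF K(2) rangeI[of "Delta T 0" x]] by (simp only: inv_f_f[OF inj]) (simp only: D)
  \<comment> \<open>\<open>K + 1\<close> in place of \<open>K\<close> keeps the denominator
    positive.\<close>
  have "1 / sqrt (K + 1) \<le> norm (lam z)" if z: "z \<in> N" for z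
  proof -
    have "norm z = 1" using N(1) z by (rule norm_orthonormal)
    then have "1 \<le> K * (norm (lam z))\<^sup>2"
      using bound[of z] by (simp add: eig z right_linearD[OF lin] norm_scaleQ power2_eq_square)
    also have "\<dots> \<le> (K + 1) * (norm (lam z))\<^sup>2"
      by (intro mult_right_mono) simp_all
    finally have "1 / (K + 1) \<le> (norm (lam z))\<^sup>2" using K(1) by (simp add: field_simps)
    then have "sqrt (1 / (K + 1)) \<le> norm (lam z)" by (simp add: real_le_lsqrt)
    then show ?thesis by (simp add: real_sqrt_divide)
  qed
  then have "{z\<in>N. 1 / sqrt (K + 1) \<le> norm (lam z)} = N" by blast
  moreover have "1 / sqrt (K + 1) > 0" using K(1) by simp
  ultimately show False
    using finite_large_eigenvalues[OF T N(1) eig] N(2) by metis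
qed

text \<open>Apart from 0, the set is a countable union of the finite sets for the thresholds
  \<open>1 / (n + 1)\<close>.\<close>

lemma vanishing_at_infinity_imp_countable:
  fixes L :: "'a::real_normed_vector set"
  assumes "\<And>\<epsilon>. \<epsilon> > 0 \<Longrightarrow> finite {l\<in>L. \<epsilon> \<le> norm l}"
  shows "countable L"
proof -
  have "L \<subseteq> {0} \<union> (\<Union>n. {l\<in>L. 1 / real (Suc n) \<le> norm l})"
  proof
    fix l assume "l \<in> L"
    show "l \<in> {0} \<union> (\<Union>n. {l\<in>L. 1 / real (Suc n) \<le> norm l})"
    proof (cases "l = 0")
      case False
      then obtain n where "1 / real (Suc n) < norm l"
        using nat_approx_posE[of "norm l"] by auto
      then show ?thesis using \<open>l \<in> L\<close> by (auto intro: less_imp_le)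
    qed simp
  qed
  moreover have "countable (\<Union>n. {l\<in>L. 1 / real (Suc n) \<le> norm l})"
    using assms by (intro countable_UN) (simp_all add: countable_finite)
  ultimately show ?thesis by (meson countable_Un countable_finite countable_subset finite.intros)
qed

text \<open>For nonzero \<open>l\<close>, points within \<open>norm l / 2\<close> of
  \<open>l\<close> have norm at least \<open>norm l / 2\<close>, so only finitely many lie in
  \<open>L\<close>.\<close>

lemma vanishing_at_infinity_imp_islimpt_zero:
  fixes L :: "'a::real_normed_vector set"
  assumes fin: "\<And>\<epsilon>. \<epsilon> > 0 \<Longrightarrow> finite {l\<in>L. \<epsilon> \<le> norm l}" and l: "l islimpt L"
  shows "l = 0"
proof (rule ccontr)
  assume "l \<noteq> 0"
  then have pos: "norm l / 2 > 0" by simp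
  have "L \<inter> ball l (norm l / 2) \<subseteq> {l'\<in>L. norm l / 2 \<le> norm l'}"
  proof safe
    fix l' assume "l' \<in> ball l (norm l / 2)"
    then show "norm l / 2 \<le> norm l'"
      using norm_triangle_ineq2[of l l'] by (simp add: dist_norm)
  qed
  then have "finite (L \<inter> ball l (norm l / 2))"
    using fin[OF pos] finite_subset by blast
  then show False
    using l pos by (simp add: islimpt_eq_infinite_ball)
qed

theorem theorem1p2:
  fixes T :: "'a::quat_hilbert \<Rightarrow> 'a"
  assumes "right_linear T" and "compact_operator T" and "normal_operator T"
  shows "\<exists>(N :: 'a set) (lam :: 'a \<Rightarrow> quat).
    hilbert_basis N \<and>
    (\<forall>z\<in>N. eigenvector T z (lam z)) \<and>
    (\<forall>x. ((\<lambda>z. z *\<^sub>Q lam z *\<^sub>Q qinner z x) has_sum T x) N) \<and>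
    (\<forall>z\<in>N. lam z \<noteq> 0 \<longrightarrow> finite {z'\<in>N. z' \<noteq> z \<and> lam z = lam z'}) \<and>
    countable (lam ` N) \<and>
    (\<forall>\<epsilon>>0. \<exists>L. L \<subseteq> lam ` N \<and> finite L \<and> (\<forall>l\<in>lam ` N - L. norm l < \<epsilon>)) \<and>
    (\<forall>l. l islimpt lam ` N \<longrightarrow> l = 0) \<and>
    (\<not> finite_dimensional_quat TYPE('a) \<longrightarrow> 0 \<in> spherical_spectrum T)"
proof -
  interpret compact_normal T "quat_adjoint T"
    using assms(2,3) by (rule compact_normal_adjoint)
  obtain N where N: "hilbert_basis N" "\<And>z. z \<in> N \<Longrightarrow> eigenvector T z (qinner z (T z))"
    using exists_eigenbasis by blast
  define lam where "lam z = qinner z (T z)" for z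
  have eig: "T z = z *\<^sub>Q lam z" if "z \<in> N" for z
    using N(2)[OF that] by (simp add: eigenvector_def lam_def)
  have orth: "orthonormal N" using N(1) by (simp add: hilbert_basis_iff_total)
  have fin: "finite {z\<in>N. \<epsilon> \<le> norm (lam z)}" if "\<epsilon> > 0" for \<epsilon>
    using finite_large_eigenvalues[OF assms(2) orth eig that] .
  have fin': "finite {l\<in>lam ` N. \<epsilon> \<le> norm l}" if "\<epsilon> > 0" for \<epsilon>
    by (rule finite_surj[OF fin[OF that], of _ lam]) auto
  have "((\<lambda>z. z *\<^sub>Q lam z *\<^sub>Q qinner z x) has_sum T x) N" for x
  proof -
    \<comment> \<open>Continuity of \<open>T\<close> allows applying it termwise to the basis
      expansion of \<open>x\<close>.\<close>
    have "((\<lambda>z. T (z *\<^sub>Q qinner z x)) has_sum T x) N"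
      by (rule has_sum_bounded_linear[OF bounded_linear_T]) (use N(1) in \<open>simp add: hilbert_basis_def\<close>)
    then show ?thesis
      by (simp add: T_simps eig cong: has_sum_cong)
  qed
  moreover have "finite {z'\<in>N. z' \<noteq> z \<and> lam z = lam z'}" if "lam z \<noteq> 0" for z
    \<comment> \<open>Elements sharing the value \<open>lam z\<close> all pass the threshold
      \<open>norm (lam z)\<close>, which is positive.\<close>
    by (rule finite_subset[OF _ fin[of "norm (lam z)"]]) (use that in auto)
  moreover have "\<exists>L. L \<subseteq> lam ` N \<and> finite L \<and> (\<forall>l\<in>lam ` N - L. norm l < \<epsilon>)" if "\<epsilon> > 0" for \<epsilon>
    using fin'[OF that] by (intro exI[of _ "{l\<in>lam ` N. \<epsilon> \<le> norm l}"]) auto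
  moreover have "0 \<in> spherical_spectrum T" if "\<not> finite_dimensional_quat TYPE('a)"
    using zero_in_spherical_spectrum[OF assms(2) orth infinite_hilbert_basis[OF N(1) that] eig] .
  moreover have "eigenvector T z (lam z)" if "z \<in> N" for z
    using N(2)[OF that] by (simp add: lam_def)
  ultimately show ?thesis
    using N(1) vanishing_at_infinity_imp_countable[OF fin']
      vanishing_at_infinity_imp_islimpt_zero[OF fin']
    by (intro exI[of _ N] exI[of _ lam]) blast
qed

end
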